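(* Let $A\in\mathbb{R}^{n\times n}$, $B\in\mathbb{R}^{n\times m}$, $K\in\mathbb{R}^{m\times n}$, and suppose that $A_{\mathrm{cl}}:=A+BK$ is Schur stable, with constants $\Gamma\ge 1$ and $\gamma\in(0,1)$ such that $\|A_{\mathrm{cl}}^k\|_\infty\le\Gamma\gamma^k$ for all $k\in\mathbb{N}_0$. Put $\delta:=\Gamma\|B\|_\infty/(1-\gamma)$. Suppose that a constant $E_0>0$ satisfying $\|x(0)\|_\infty\le E_0$ is known, and consider the quantized self-triggered closed-loop system described in the context, with upper bound $\tau_{\max}\in\mathbb{N}$ of inter-sampling times, number $N\in\mathbb{N}$ of quantization levels and threshold parameter $\sigma>0$. If $$\frac{\|K\|_\infty}{N}\le\sigma<\frac{1}{\delta}=\frac{1-\gamma}{\Gamma\|B\|_\infty},$$ then the closed-loop system achieves exponential convergence, that is, there exist constants $\Omega\ge1$ and $\omega\in(0,1)$, independent of $E_0$, such that $$\|x(k)\|_\infty\le\Omega E_0\,\omega^k\qquad\text{for all }k\in\mathbb{N}_0$$ for every initial state $x(0)\in\mathbb{R}^n$ satisfying $\|x(0)\|_\infty\le E_0$. Moreover, this bound holds for some $\Omega\ge1$ with the constant $$\omega:=\big(\gamma^{\tau_{\max}}(1-\delta\sigma)+\delta\sigma\big)^{1/\tau_{\max}}.$$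
   Context: Notation. $\mathbb{N}=\{1,2,\dots\}$ and $\mathbb{N}_0=\{0,1,2,\dots\}$. $\|v\|_\infty$ is the maximum norm of a vector, $\|M\|_\infty$ the induced matrix norm (maximum absolute row sum), $I_n$ the identity matrix. Empty sums are $0$. A matrix is Schur stable if all its eigenvalues have modulus less than $1$. System. With state $x(k)\in\mathbb{R}^n$ and input $u(k)\in\mathbb{R}^m$, $$x(k+1)=Ax(k)+Bu(k),\quad k\in\mathbb{N}_0,\qquad u(k)=Kq_\ell\ \text{ for } k_\ell\le k<k_{\ell+1},\ \ell\in\mathbb{N}_0,$$ where $k_0=0$, $\{k_\ell\}_{\ell\in\mathbb{N}_0}$ are the sampling times and $q_\ell\in\mathbb{R}^n$ is the quantized value of $x(k_\ell)$. Encoding and decoding. Let $n=n_1+\dots+n_\eta$ with $\eta,n_1,\dots,n_\eta\in\mathbb{N}$, and partition the state into blocks $x^{\langle i\rangle}(k_\ell)\in\mathbb{R}^{n_i}$, $i=1,\dots,\eta$ (block $i$ being measured by sensor $i$). Given a state bound $E_\ell>0$ with $\|x(k_\ell)\|_\infty\le E_\ell$, for each $i$ the hypercube $\{\xi\in\mathbb{R}^{n_i}:\|\xi\|_\infty\le E_\ell\}$ is divided into $N^{n_i}$ equal hypercubes, and $q_\ell^{\langle i\rangle}$ is the center of one of these (closed) hypercubes that contains $x^{\langle i\rangle}(k_\ell)$; if there are several, any of them can be chosen. The vector $q_\ell$ is the vector with blocks $q_\ell^{\langle1\rangle},\dots,q_\ell^{\langle\eta\rangle}$. Self-triggering mechanism.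 The sampling times are generated by $$k_{\ell+1}:=k_\ell+\min\{\tau_{\max},\tau_\ell\},\quad k_0:=0,\qquad \tau_\ell:=\min\{\tau\in\mathbb{N}: g(q_\ell,E_\ell,\tau)>\sigma E_\ell\},\quad \ell\in\mathbb{N}_0,$$ with the convention $\min\emptyset=+\infty$, where for $q\in\mathbb{R}^n$, $E\ge0$, $\tau\in\mathbb{N}_0$, $$g(q,E,\tau):=\Big\|K\Big(I_n-A^\tau-\sum_{p=0}^{\tau-1}A^pBK\Big)q\Big\|_\infty+\|KA^\tau\|_\infty\frac{E}{N}.$$ State bounds. $E_0$ is the given initial bound; with the constants $\Gamma,\gamma,\delta,\sigma$ of the claim, $\widetilde E_0:=\Gamma E_0$, $$\widetilde E_{\ell+1}:=\big(\gamma^{k_{\ell+1}-k_\ell}(1-\delta\sigma)+\delta\sigma\big)\widetilde E_\ell\quad(\ell\in\mathbb{N}_0),\qquad E_\ell:=\widetilde E_\ell\quad(\ell\in\mathbb{N}).$$ *)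

theory Defs
  imports "HOL-Analysis.Analysis"
begin

text \<open>The maximum norm of a vector is the library's \<^const>\<open>infnorm\<close>.\<close>

primrec mat_pow :: "real ^ 'n ^ 'n \<Rightarrow> nat \<Rightarrow> real ^ 'n ^ 'n" where
  "mat_pow M 0 = mat 1"
| "mat_pow M (Suc k) = M ** mat_pow M k"

definition mat_infnorm :: "real ^ 'c ^ 'r \<Rightarrow> real" where
  "mat_infnorm M = Max (range (\<lambda>i. \<Sum>j\<in>UNIV. \<bar>M $ i $ j\<bar>))"

definition complex_eigenvalue :: "real ^ 'n ^ 'n \<Rightarrow> complex \<Rightarrow> bool" where
  "complex_eigenvalue M z \<longleftrightarrow>
     (\<exists>v :: complex ^ 'n. v \<noteq> 0 \<and> map_matrix complex_of_real M *v v = z *s v)"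

definition schur_stable :: "real ^ 'n ^ 'n \<Rightarrow> bool" where
  "schur_stable M \<longleftrightarrow> (\<forall>z. complex_eigenvalue M z \<longrightarrow> cmod z < 1)"

text \<open>
  A block of coordinates is an index set \<open>S\<close>; an element of the corresponding space
  is a function of which only the values on \<open>S\<close> matter. Dividing the hypercube of radius
  \<open>E\<close> into \<open>N\<close> parts along each coordinate gives hypercubes of radius \<open>E / N\<close>, whose
  centers have the coordinates \<open>- E + (2 j + 1) E / N\<close> with \<open>j = 0, \<dots>, N - 1\<close>.
\<close>

definition subcube_centers :: "'n set \<Rightarrow> nat \<Rightarrow> real \<Rightarrow> ('n \<Rightarrow> real) set" where
  "subcube_centers S N E =
     {c. \<exists>j :: 'n \<Rightarrow> nat. \<forall>s\<in>S. j s < N \<and> c s = - E + (2 * real (j s) + 1) * (E / real N)}"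

definition subcube :: "'n set \<Rightarrow> nat \<Rightarrow> real \<Rightarrow> ('n \<Rightarrow> real) \<Rightarrow> ('n \<Rightarrow> real) set" where
  "subcube S N E c = {\<xi>. \<forall>s\<in>S. \<bar>\<xi> s - c s\<bar> \<le> E / real N}"

text \<open>
  The map \<open>sensor\<close> assigns to each coordinate the number of the sensor that measures it.
  A point on a common face of several hypercubes has several admissible quantized values,
  so quantization is a relation.
\<close>

definition quantized_value ::
  "('n \<Rightarrow> nat) \<Rightarrow> nat \<Rightarrow> nat \<Rightarrow> real \<Rightarrow> real ^ 'n \<Rightarrow> real ^ 'n \<Rightarrow> bool" where
  "quantized_value sensor \<eta> N E x q \<longleftrightarrow>
     (\<forall>i\<in>{1..\<eta>}. let S = {s. sensor s = i} in
        ($) q \<in> subcube_centers S N E \<and> ($) x \<in> subcube S N E (($) q))"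

definition trigger_fun ::
  "real ^ 'n ^ 'n \<Rightarrow> real ^ 'm ^ 'n \<Rightarrow> real ^ 'n ^ 'm \<Rightarrow> nat \<Rightarrow> real ^ 'n \<Rightarrow> real \<Rightarrow> nat \<Rightarrow> real" where
  "trigger_fun A B K N q E \<tau> =
     infnorm ((K ** (mat 1 - mat_pow A \<tau> - (\<Sum>p<\<tau>. mat_pow A p ** B ** K))) *v q)
     + mat_infnorm (K ** mat_pow A \<tau>) * (E / real N)"

text \<open>The infimum of the empty set in \<^typ>\<open>enat\<close> is \<open>\<infinity>\<close>.\<close>

definition trigger_time ::
  "real ^ 'n ^ 'n \<Rightarrow> real ^ 'm ^ 'n \<Rightarrow> real ^ 'n ^ 'm \<Rightarrow> nat \<Rightarrow> real \<Rightarrow> real ^ 'n \<Rightarrow> real \<Rightarrow> enat" where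
  "trigger_time A B K N \<sigma> q E = Inf (enat ` {\<tau>. 1 \<le> \<tau> \<and> trigger_fun A B K N q E \<tau> > \<sigma> * E})"

primrec aux_bound ::
  "real \<Rightarrow> real \<Rightarrow> real \<Rightarrow> real \<Rightarrow> real \<Rightarrow> (nat \<Rightarrow> nat) \<Rightarrow> nat \<Rightarrow> real" where
  "aux_bound \<Gamma> \<gamma> \<delta> \<sigma> E0 ks 0 = \<Gamma> * E0"
| "aux_bound \<Gamma> \<gamma> \<delta> \<sigma> E0 ks (Suc l) =
     (\<gamma> ^ (ks (Suc l) - ks l) * (1 - \<delta> * \<sigma>) + \<delta> * \<sigma>) * aux_bound \<Gamma> \<gamma> \<delta> \<sigma> E0 ks l"

definition state_bound ::
  "real \<Rightarrow> real \<Rightarrow> real \<Rightarrow> real \<Rightarrow> real \<Rightarrow> (nat \<Rightarrow> nat) \<Rightarrow> nat \<Rightarrow> real" where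
  "state_bound \<Gamma> \<gamma> \<delta> \<sigma> E0 ks l = (if l = 0 then E0 else aux_bound \<Gamma> \<gamma> \<delta> \<sigma> E0 ks l)"

text \<open>
  Quantization is only specified while the state satisfies its bound, so the clause on \<open>q\<close>
  is conditional and leaves \<open>q l\<close> arbitrary otherwise. That the bound is never violated is
  not part of the definition; an unconditional clause would silently assume it.
\<close>

definition closed_loop ::
  "real ^ 'n ^ 'n \<Rightarrow> real ^ 'm ^ 'n \<Rightarrow> real ^ 'n ^ 'm \<Rightarrow> ('n \<Rightarrow> nat) \<Rightarrow> nat \<Rightarrow> nat \<Rightarrow> nat \<Rightarrow>
   real \<Rightarrow> real \<Rightarrow> real \<Rightarrow> real \<Rightarrow> real \<Rightarrow>
   (nat \<Rightarrow> real ^ 'n) \<Rightarrow> (nat \<Rightarrow> real ^ 'm) \<Rightarrow> (nat \<Rightarrow> real ^ 'n) \<Rightarrow> (nat \<Rightarrow> nat) \<Rightarrow> bool" where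
  "closed_loop A B K sensor \<eta> N \<tau>max \<sigma> \<Gamma> \<gamma> \<delta> E0 x u q ks \<longleftrightarrow>
     (let E = state_bound \<Gamma> \<gamma> \<delta> \<sigma> E0 ks in
       (\<forall>k. x (Suc k) = A *v x k + B *v u k) \<and>
       (\<forall>l k. ks l \<le> k \<and> k < ks (Suc l) \<longrightarrow> u k = K *v q l) \<and>
       (\<forall>l. E l > 0 \<and> infnorm (x (ks l)) \<le> E l \<longrightarrow>
            quantized_value sensor \<eta> N (E l) (x (ks l)) (q l)) \<and>
       ks 0 = 0 \<and>
       (\<forall>l. enat (ks (Suc l)) =
            enat (ks l) + min (enat \<tau>max) (trigger_time A B K N \<sigma> (q l) (E l))))"

definition exponential_bound ::
  "real ^ 'n ^ 'n \<Rightarrow> real ^ 'm ^ 'n \<Rightarrow> real ^ 'n ^ 'm \<Rightarrow> ('n \<Rightarrow> nat) \<Rightarrow> nat \<Rightarrow> nat \<Rightarrow> nat \<Rightarrow>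
   real \<Rightarrow> real \<Rightarrow> real \<Rightarrow> real \<Rightarrow> real \<Rightarrow> real \<Rightarrow> bool" where
  "exponential_bound A B K sensor \<eta> N \<tau>max \<sigma> \<Gamma> \<gamma> \<delta> \<Omega> \<omega> \<longleftrightarrow>
     (\<forall>E0>0. \<forall>x u q ks.
        closed_loop A B K sensor \<eta> N \<tau>max \<sigma> \<Gamma> \<gamma> \<delta> E0 x u q ks \<and> infnorm (x 0) \<le> E0 \<longrightarrow>
        (\<forall>k. infnorm (x k) \<le> \<Omega> * E0 * \<omega> ^ k))"

end

theory Submission
  imports Defs
begin

text \<open>
  In the closed loop the input is \<open>u k = K *v x k + w k\<close>, where \<open>w\<close> is the error made by
  quantizing and holding the measurement, so the state follows the Schur stable system
  \<open>A + B ** K\<close> perturbed by \<open>B *v w k\<close>. The self-trigger is designed so that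
  \<open>infnorm (w k) \<le> \<sigma> * E l\<close> throughout the \<open>l\<close>-th sampling interval
  (\<open>trigger_fun_bounds_input_error\<close>): at the sampling instant this is the hypothesis
  \<open>mat_infnorm K / N \<le> \<sigma>\<close>, and afterwards it is the negation of the trigger condition.

  Since powers of \<open>A + B ** K\<close> contract only up to the factor \<open>\<Gamma>\<close>, iterating bounds in the
  maximum norm over sampling intervals would lose a factor \<open>\<Gamma>\<close> each time. The remedy is the
  adapted norm \<open>\<parallel>v\<parallel>\<^sub>* = (SUP j. infnorm ((A + B ** K)\<^sup>j v) / \<gamma>\<^sup>j)\<close>, for which \<open>A + B ** K\<close> is a
  genuine \<open>\<gamma>\<close>-contraction and which lies between \<open>infnorm\<close> and \<open>\<Gamma> * infnorm\<close>. In this norm,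
  \<open>t\<close> steps after a sampling instant with \<open>\<parallel>x\<parallel>\<^sub>* \<le> e\<close> the state is bounded by
  \<open>(\<gamma> ^ t * (1 - \<delta> * \<sigma>) + \<delta> * \<sigma>) * e\<close>; this is exactly the recursion of \<open>aux_bound\<close>, so
  \<open>aux_bound\<close> dominates the adapted norm at all sampling times, and the factor \<open>\<Gamma>\<close> is paid
  only once, at time zero.

  It remains to compare the contraction factors for different interval lengths. The factor
  \<open>\<gamma> ^ t * (1 - \<delta> * \<sigma>) + \<delta> * \<sigma>\<close> is a weighted mean of \<open>\<gamma> ^ t\<close> and \<open>1 ^ t\<close>, so by the
  power mean inequality its \<open>t\<close>-th root increases with \<open>t\<close>: the longest interval is the worst
  one per unit of time (\<open>mean_power_le_root_power\<close>). Hence the bound at time \<open>k\<close> is at most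
  \<open>\<Gamma> * E0 * \<omega> ^ k\<close>, with \<open>\<Omega> = \<Gamma>\<close>.
\<close>

section \<open>Maximum norms\<close>

lemma infnorm_le_cart:
  fixes v :: "real ^ 'n"
  assumes "\<And>i. \<bar>v $ i\<bar> \<le> c"
  shows "infnorm v \<le> c"
  unfolding infnorm_cart by (rule cSup_least) (use assms in auto)

lemma row_sum_le_mat_infnorm: "(\<Sum>j\<in>UNIV. \<bar>M $ i $ j\<bar>) \<le> mat_infnorm M"
  unfolding mat_infnorm_def by (rule Max_ge) auto

lemma mat_infnorm_nonneg: "0 \<le> mat_infnorm M"
  by (rule order_trans[OF sum_nonneg row_sum_le_mat_infnorm]) simp

lemma infnorm_mult_le:
  fixes M :: "real ^ 'c ^ 'r"
  shows "infnorm (M *v v) \<le> mat_infnorm M * infnorm v"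
proof (rule infnorm_le_cart)
  fix i
  have "\<bar>(M *v v) $ i\<bar> \<le> (\<Sum>j\<in>UNIV. \<bar>M $ i $ j * v $ j\<bar>)"
    unfolding matrix_vector_mult_def by (simp add: sum_abs)
  also have "\<dots> \<le> (\<Sum>j\<in>UNIV. \<bar>M $ i $ j\<bar> * infnorm v)"
    by (intro sum_mono) (simp add: abs_mult mult_left_mono component_le_infnorm_cart)
  also have "\<dots> = (\<Sum>j\<in>UNIV. \<bar>M $ i $ j\<bar>) * infnorm v"
    by (simp add: sum_distrib_right)
  also have "\<dots> \<le> mat_infnorm M * infnorm v"
    by (intro mult_right_mono row_sum_le_mat_infnorm infnorm_pos_le)
  finally show "\<bar>(M *v v) $ i\<bar> \<le> mat_infnorm M * infnorm v" .
qed

lemma mat_pow_Suc_right: "mat_pow M (Suc k) = mat_pow M k ** M"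
  by (induction k) (simp_all add: matrix_mul_assoc)

section \<open>The adapted norm\<close>

text \<open>
  The ball of radius \<open>c\<close> of the adapted norm. Using balls instead of the norm itself avoids
  the supremum and its boundedness side conditions.
\<close>

definition adapted_ball :: "real ^ 'n ^ 'n \<Rightarrow> real \<Rightarrow> real \<Rightarrow> (real ^ 'n) set" where
  "adapted_ball M \<gamma> c = {v. \<forall>j. infnorm (mat_pow M j *v v) \<le> \<gamma> ^ j * c}"

lemma adapted_ball_infnorm_le:
  assumes "v \<in> adapted_ball M \<gamma> c"
  shows "infnorm v \<le> c"
proof -
  have "infnorm (mat_pow M 0 *v v) \<le> \<gamma> ^ 0 * c"
    using assms unfolding adapted_ball_def by blast
  then show ?thesis by simp
qed

lemma mem_adapted_ball_of_infnorm_le: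
  assumes growth: "\<And>k. mat_infnorm (mat_pow M k) \<le> \<Gamma> * \<gamma> ^ k"
    and "infnorm v \<le> c"
  shows "v \<in> adapted_ball M \<gamma> (\<Gamma> * c)"
proof -
  have "infnorm (mat_pow M j *v v) \<le> \<gamma> ^ j * (\<Gamma> * c)" for j
  proof -
    have "infnorm (mat_pow M j *v v) \<le> mat_infnorm (mat_pow M j) * infnorm v"
      by (rule infnorm_mult_le)
    also have "\<dots> \<le> \<Gamma> * \<gamma> ^ j * c"
      using growth[of j] assms(2) mat_infnorm_nonneg[of "mat_pow M j"] infnorm_pos_le[of v]
      by (intro mult_mono) auto
    finally show ?thesis by (simp add: mult_ac)
  qed
  then show ?thesis unfolding adapted_ball_def by simp
qed

lemma adapted_ball_mult:
  assumes "v \<in> adapted_ball M \<gamma> c"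
  shows "M *v v \<in> adapted_ball M \<gamma> (\<gamma> * c)"
proof -
  have "infnorm (mat_pow M j *v (M *v v)) \<le> \<gamma> ^ j * (\<gamma> * c)" for j
  proof -
    have "infnorm (mat_pow M (Suc j) *v v) \<le> \<gamma> ^ Suc j * c"
      using assms unfolding adapted_ball_def by blast
    then show ?thesis
      unfolding mat_pow_Suc_right by (simp add: matrix_vector_mul_assoc mult_ac)
  qed
  then show ?thesis unfolding adapted_ball_def by simp
qed

lemma adapted_ball_add:
  assumes "v \<in> adapted_ball M \<gamma> c" "w \<in> adapted_ball M \<gamma> d"
  shows "v + w \<in> adapted_ball M \<gamma> (c + d)"
proof -
  have "infnorm (mat_pow M j *v (v + w)) \<le> \<gamma> ^ j * (c + d)" for j
  proof -
    have "infnorm (mat_pow M j *v v) \<le> \<gamma> ^ j * c" "infnorm (mat_pow M j *v w) \<le> \<gamma> ^ j * d"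
      using assms unfolding adapted_ball_def by blast+
    then show ?thesis
      using infnorm_triangle[of "mat_pow M j *v v" "mat_pow M j *v w"]
      by (simp add: matrix_vector_right_distrib distrib_left)
  qed
  then show ?thesis unfolding adapted_ball_def by simp
qed

text \<open>
  A disturbance bounded by \<open>c\<close> drives the adapted norm towards the fixed point
  \<open>\<Gamma> * mat_infnorm B * c / (1 - \<gamma>)\<close> of the scalar recursion
  \<open>e \<mapsto> \<gamma> * e + \<Gamma> * mat_infnorm B * c\<close>, at rate \<open>\<gamma>\<close>.
\<close>

lemma perturbed_orbit_in_adapted_ball:
  fixes M :: "real ^ 'n ^ 'n" and B :: "real ^ 'm ^ 'n"
  assumes growth: "\<And>k. mat_infnorm (mat_pow M k) \<le> \<Gamma> * \<gamma> ^ k"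
    and "\<gamma> < 1"
    and \<delta>: "\<delta> = \<Gamma> * mat_infnorm B / (1 - \<gamma>)"
    and step: "\<And>t. t < T \<Longrightarrow> y (Suc t) = M *v y t + B *v w t"
    and small: "\<And>t. t < T \<Longrightarrow> infnorm (w t) \<le> c"
    and init: "y 0 \<in> adapted_ball M \<gamma> e"
    and "t \<le> T"
  shows "y t \<in> adapted_ball M \<gamma> (\<gamma> ^ t * e + (1 - \<gamma> ^ t) * (\<delta> * c))"
  using \<open>t \<le> T\<close>
proof (induction t)
  case 0
  then show ?case using init by simp
next
  case (Suc t)
  let ?e = "\<gamma> ^ t * e + (1 - \<gamma> ^ t) * (\<delta> * c)"
  have "infnorm (B *v w t) \<le> mat_infnorm B * c"
    using infnorm_mult_le[of B "w t"] small[of t] Suc.prems mat_infnorm_nonneg[of B]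
    by (meson Suc_le_lessD mult_left_mono order_trans)
  then have "B *v w t \<in> adapted_ball M \<gamma> (\<Gamma> * (mat_infnorm B * c))"
    by (rule mem_adapted_ball_of_infnorm_le[OF growth])
  moreover have "M *v y t \<in> adapted_ball M \<gamma> (\<gamma> * ?e)"
    using Suc by (intro adapted_ball_mult) simp
  ultimately have "y (Suc t) \<in> adapted_ball M \<gamma> (\<gamma> * ?e + \<Gamma> * (mat_infnorm B * c))"
    using step[of t] Suc.prems adapted_ball_add by fastforce
  moreover have "\<Gamma> * (mat_infnorm B * c) = (1 - \<gamma>) * (\<delta> * c)"
    using \<open>\<gamma> < 1\<close> unfolding \<delta> by simp
  moreover have "\<gamma> * ?e + (1 - \<gamma>) * (\<delta> * c)
      = \<gamma> ^ Suc t * e + (1 - \<gamma> ^ Suc t) * (\<delta> * c)"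
    by (simp add: algebra_simps)
  ultimately show ?case by simp
qed

section \<open>Comparing interval lengths\<close>

text \<open>
  Power mean inequality: Jensen's inequality for \<open>s \<mapsto> s powr (T / t)\<close>, applied to the mean of
  \<open>\<gamma> ^ t\<close> and \<open>1\<close> with weights \<open>1 - b\<close> and \<open>b\<close>, gives \<open>f t powr (T / t) \<le> f T\<close> for
  \<open>f t = \<gamma> ^ t * (1 - b) + b\<close>.
\<close>

lemma mean_power_le_root_power:
  fixes \<gamma> b :: real
  assumes "0 < \<gamma>" "0 \<le> b" "b < 1" "t \<le> T" "1 \<le> T"
  shows "\<gamma> ^ t * (1 - b) + b \<le> ((\<gamma> ^ T * (1 - b) + b) powr (1 / real T)) ^ t"
proof (cases "t = 0")
  case True
  then show ?thesis by simp
next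
  case False
  define p where "p = real T / real t"
  let ?f = "\<lambda>t. \<gamma> ^ t * (1 - b) + b"
  have p: "p \<ge> 1" using assms False by (simp add: p_def)
  have pos: "?f s > 0" for s
    using assms by (intro add_pos_nonneg mult_pos_pos) auto
  have "((1 - b) *\<^sub>R \<gamma> ^ t + b *\<^sub>R 1) powr p \<le> (1 - b) * (\<gamma> ^ t) powr p + b * 1 powr p"
    by (rule convex_onD[OF powr_convex[OF p]]) (use assms in auto)
  also have "(\<gamma> ^ t) powr p = \<gamma> ^ T"
    using assms False by (simp add: p_def powr_powr flip: powr_realpow)
  finally have jensen: "?f t powr p \<le> ?f T"
    by (simp add: mult.commute)
  have "?f t = (?f t powr p) powr (real t / real T)"
    using assms False pos[of t] by (simp add: p_def powr_powr)
  also have "\<dots> \<le> ?f T powr (real t / real T)"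
    using jensen by (intro powr_mono2) auto
  also have "\<dots> = (?f T powr (1 / real T)) ^ t"
    using pos[of T] by (simp add: powr_powr flip: powr_realpow)
  finally show ?thesis .
qed

section \<open>The error of the sampled input\<close>

lemma mat_pow_sum_Suc:
  fixes A :: "real ^ 'n ^ 'n" and B :: "real ^ 'm ^ 'n" and K :: "real ^ 'n ^ 'm"
  shows "(\<Sum>p<Suc t. mat_pow A p ** B ** K) = A ** (\<Sum>p<t. mat_pow A p ** B ** K) + B ** K"
proof (induction t)
  case 0
  have "A ** (0 :: real ^ 'n ^ 'n) = 0"
    by (simp add: matrix_matrix_mult_def zero_vec_def)
  then show ?case by simp
next
  case (Suc t)
  let ?S = "\<lambda>t. \<Sum>p<t. mat_pow A p ** B ** K"
  have "?S (Suc (Suc t)) = ?S (Suc t) + mat_pow A (Suc t) ** B ** K"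
    by simp
  also have "\<dots> = A ** ?S t + B ** K + A ** (mat_pow A t ** B ** K)"
    unfolding Suc.IH by (simp add: matrix_mul_assoc)
  also have "\<dots> = A ** ?S (Suc t) + B ** K"
    by (simp add: matrix_add_ldistrib)
  finally show ?case .
qed

lemma held_input_orbit:
  fixes A :: "real ^ 'n ^ 'n" and B :: "real ^ 'm ^ 'n" and K :: "real ^ 'n ^ 'm"
  assumes "\<And>t. t < T \<Longrightarrow> y (Suc t) = A *v y t + B *v (K *v q)"
    and "t \<le> T"
  shows "y t = mat_pow A t *v y 0 + (\<Sum>p<t. mat_pow A p ** B ** K) *v q"
  using assms(2)
proof (induction t)
  case 0
  then show ?case by simp
next
  case (Suc t)
  then have "y (Suc t) = A *v (mat_pow A t *v y 0 + (\<Sum>p<t. mat_pow A p ** B ** K) *v q) + B *v (K *v q)"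
    using assms(1)[of t] by simp
  also have "\<dots> = mat_pow A (Suc t) *v y 0
      + (A ** (\<Sum>p<t. mat_pow A p ** B ** K) + B ** K) *v q"
    by (simp add: matrix_vector_right_distrib matrix_vector_mul_assoc
        matrix_vector_mult_add_rdistrib)
  finally show ?case unfolding mat_pow_sum_Suc .
qed

text \<open>
  The trigger function is computable from \<open>q\<close> alone; it bounds the input error because the
  true state \<open>y t\<close> differs from the state predicted from \<open>q\<close> by \<open>mat_pow A t *v (y 0 - q)\<close>.
\<close>

lemma trigger_fun_bounds_input_error:
  fixes A :: "real ^ 'n ^ 'n" and B :: "real ^ 'm ^ 'n" and K :: "real ^ 'n ^ 'm"
  assumes step: "\<And>t. t < T \<Longrightarrow> y (Suc t) = A *v y t + B *v (K *v q)"
    and "t \<le> T"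
    and quant: "infnorm (y 0 - q) \<le> E / real N"
  shows "infnorm (K *v q - K *v y t) \<le> trigger_fun A B K N q E t"
proof -
  let ?S = "\<Sum>p<t. mat_pow A p ** B ** K"
  have "y t = mat_pow A t *v y 0 + ?S *v q"
    using step \<open>t \<le> T\<close> by (rule held_input_orbit)
  then have orbit: "K *v y t = K *v (mat_pow A t *v y 0 + ?S *v q)"
    by (rule arg_cong)
  have "K *v q - K *v y t
      = (K ** (mat 1 - mat_pow A t - ?S)) *v q + - ((K ** mat_pow A t) *v (y 0 - q))"
    unfolding orbit by (simp add: algebra_simps flip: matrix_vector_mul_assoc)
  then have "infnorm (K *v q - K *v y t)
      \<le> infnorm ((K ** (mat 1 - mat_pow A t - ?S)) *v q)
        + infnorm ((K ** mat_pow A t) *v (y 0 - q))"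
    using infnorm_triangle infnorm_neg by metis
  also have "infnorm ((K ** mat_pow A t) *v (y 0 - q))
      \<le> mat_infnorm (K ** mat_pow A t) * (E / real N)"
    using quant mat_infnorm_nonneg infnorm_mult_le by (meson mult_left_mono order_trans)
  finally show ?thesis unfolding trigger_fun_def by simp
qed

lemma trigger_fun_0:
  fixes A :: "real ^ 'n ^ 'n" and B :: "real ^ 'm ^ 'n" and K :: "real ^ 'n ^ 'm"
  shows "trigger_fun A B K N q E 0 = mat_infnorm K * (E / real N)"
proof -
  have "K ** (0 :: real ^ 'n ^ 'n) = 0"
    by (simp add: matrix_matrix_mult_def zero_vec_def)
  then show ?thesis by (simp add: trigger_fun_def infnorm_0)
qed

lemma trigger_time_ge_1: "1 \<le> trigger_time A B K N \<sigma> q E"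
  unfolding trigger_time_def by (intro Inf_greatest) (auto simp: one_enat_def)

lemma trigger_fun_le_before_trigger_time:
  assumes "1 \<le> t" "enat t < trigger_time A B K N \<sigma> q E"
  shows "trigger_fun A B K N q E t \<le> \<sigma> * E"
proof (rule ccontr)
  assume "\<not> ?thesis"
  then have "trigger_time A B K N \<sigma> q E \<le> enat t"
    unfolding trigger_time_def using assms(1) by (intro Inf_lower) auto
  with assms(2) show False by simp
qed

lemma quantized_value_error:
  fixes x q :: "real ^ 'n"
  assumes "quantized_value sensor \<eta> N E x q" "range sensor = {1..\<eta>}"
  shows "infnorm (x - q) \<le> E / real N"
proof (rule infnorm_le_cart)
  fix s
  have "sensor s \<in> {1..\<eta>}" using assms(2) by blast
  then have "($) x \<in> subcube {s'. sensor s' = sensor s} N E (($) q)"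
    using assms(1) unfolding quantized_value_def Let_def by blast
  then show "\<bar>(x - q) $ s\<bar> \<le> E / real N"
    unfolding subcube_def by simp
qed

section \<open>Convergence of the closed loop\<close>

lemma interval_containing:
  fixes ks :: "nat \<Rightarrow> nat"
  assumes "ks 0 = 0" "\<And>l. ks l < ks (Suc l)"
  obtains l where "ks l \<le> k" "k < ks (Suc l)"
proof -
  have "strict_mono ks" using assms(2) by (simp add: strict_mono_Suc_iff)
  then have "k < ks (Suc k)"
    using strict_mono_imp_increasing[of ks "Suc k"] by simp
  then have ex: "\<exists>l. k < ks (Suc l)" by blast
  define l where "l = (LEAST l. k < ks (Suc l))"
  have "k < ks (Suc l)" unfolding l_def using ex by (rule LeastI_ex)
  moreover have "ks l \<le> k"
  proof (cases l)
    case 0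
    then show ?thesis using assms(1) by simp
  next
    case (Suc m)
    then have "\<not> k < ks (Suc m)"
      unfolding l_def by (intro not_less_Least) simp
    then show ?thesis using Suc by simp
  qed
  ultimately show ?thesis using that by blast
qed

theorem mainTheorem1:
  fixes A :: "real ^ 'n ^ 'n" and B :: "real ^ 'm ^ 'n" and K :: "real ^ 'n ^ 'm"
    and \<Gamma> \<gamma> \<delta> \<sigma> :: real
    and sensor :: "'n \<Rightarrow> nat" and \<eta> N \<tau>max :: nat
  assumes "schur_stable (A + B ** K)"
    and "\<Gamma> \<ge> 1" and "0 < \<gamma>" and "\<gamma> < 1"
    and "\<forall>k. mat_infnorm (mat_pow (A + B ** K) k) \<le> \<Gamma> * \<gamma> ^ k"
    and "\<delta> = \<Gamma> * mat_infnorm B / (1 - \<gamma>)"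
    and "range sensor = {1..\<eta>}"
    and "\<tau>max \<ge> 1" and "N \<ge> 1" and "\<sigma> > 0"
    and "mat_infnorm K / real N \<le> \<sigma>"
    and "\<delta> \<noteq> 0 \<Longrightarrow> \<sigma> < 1 / \<delta>" \<comment> \<open>for \<open>\<delta> = 0\<close>, \<open>1 / \<delta>\<close> is read as \<open>\<infinity>\<close>\<close>
  shows "(\<exists>\<Omega>\<ge>1. \<exists>\<omega>. 0 < \<omega> \<and> \<omega> < 1 \<and>
            exponential_bound A B K sensor \<eta> N \<tau>max \<sigma> \<Gamma> \<gamma> \<delta> \<Omega> \<omega>) \<and>
         (let \<omega> = (\<gamma> ^ \<tau>max * (1 - \<delta> * \<sigma>) + \<delta> * \<sigma>) powr (1 / real \<tau>max) in
            0 < \<omega> \<and> \<omega> < 1 \<and>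
            (\<exists>\<Omega>\<ge>1. exponential_bound A B K sensor \<eta> N \<tau>max \<sigma> \<Gamma> \<gamma> \<delta> \<Omega> \<omega>))"
proof -
  let ?M = "A + B ** K"
  define f where "f = (\<lambda>t. \<gamma> ^ t * (1 - \<delta> * \<sigma>) + \<delta> * \<sigma>)"
  define \<omega> where "\<omega> = f \<tau>max powr (1 / real \<tau>max)"
  have growth: "\<And>k. mat_infnorm (mat_pow ?M k) \<le> \<Gamma> * \<gamma> ^ k"
    using assms by blast
  have "\<delta> \<ge> 0" using assms mat_infnorm_nonneg[of B] by simp
  have b0: "0 \<le> \<delta> * \<sigma>" using \<open>\<delta> \<ge> 0\<close> \<open>\<sigma> > 0\<close> by simp
  have b1: "\<delta> * \<sigma> < 1"
    using \<open>\<delta> \<ge> 0\<close> assms(12) by (cases "\<delta> = 0") (auto simp: field_simps)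
  have fpos: "f t > 0" for t
    unfolding f_def using assms b0 b1 by (intro add_pos_nonneg mult_pos_pos) auto
  have "f \<tau>max < 1"
  proof -
    have "\<gamma> ^ \<tau>max < 1" using assms by (simp add: power_less_one_iff)
    then have "\<gamma> ^ \<tau>max * (1 - \<delta> * \<sigma>) < 1 * (1 - \<delta> * \<sigma>)"
      using b1 by (intro mult_strict_right_mono) auto
    then show ?thesis unfolding f_def by simp
  qed
  then have \<omega>1: "\<omega> < 1"
    using powr_less_mono2[of "1 / real \<tau>max" "f \<tau>max" 1] fpos[of \<tau>max] \<open>\<tau>max \<ge> 1\<close>
    unfolding \<omega>_def by fastforce
  have \<omega>0: "\<omega> > 0" unfolding \<omega>_def using fpos[of \<tau>max] by simp
  have f_le: "f t \<le> \<omega> ^ t" if "t \<le> \<tau>max" for t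
    unfolding f_def \<omega>_def using that assms b0 b1
    by (intro mean_power_le_root_power) auto

  have main: "infnorm (x k) \<le> \<Gamma> * E0 * \<omega> ^ k"
    if "E0 > 0" and cl: "closed_loop A B K sensor \<eta> N \<tau>max \<sigma> \<Gamma> \<gamma> \<delta> E0 x u q ks"
      and x0: "infnorm (x 0) \<le> E0" for E0 x u q ks k
  proof -
    define E where "E = state_bound \<Gamma> \<gamma> \<delta> \<sigma> E0 ks"
    define E' where "E' = aux_bound \<Gamma> \<gamma> \<delta> \<sigma> E0 ks"
    have dyn: "x (Suc k) = A *v x k + B *v u k" for k
      using cl unfolding closed_loop_def Let_def by blast
    have hold: "u k = K *v q l" if "ks l \<le> k" "k < ks (Suc l)" for k l
      using cl that unfolding closed_loop_def Let_def by blast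
    have quant: "quantized_value sensor \<eta> N (E l) (x (ks l)) (q l)"
      if "E l > 0" "infnorm (x (ks l)) \<le> E l" for l
      using cl that unfolding closed_loop_def Let_def E_def by blast
    have ks0: "ks 0 = 0"
      using cl unfolding closed_loop_def Let_def by blast
    have ks_Suc: "enat (ks (Suc l))
        = enat (ks l) + min (enat \<tau>max) (trigger_time A B K N \<sigma> (q l) (E l))" for l
      using cl unfolding closed_loop_def Let_def E_def by blast

    have gap: "ks l < ks (Suc l)" "ks (Suc l) - ks l \<le> \<tau>max"
      "enat (ks (Suc l) - ks l) \<le> trigger_time A B K N \<sigma> (q l) (E l)" for l
    proof -
      let ?d = "min (enat \<tau>max) (trigger_time A B K N \<sigma> (q l) (E l))"
      obtain d where d: "?d = enat d"
        by (metis enat_ord_simps(4) min.strict_coboundedI1 not_infinity_eq)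
      have "1 \<le> ?d" using assms trigger_time_ge_1 by (simp add: one_enat_def)
      then have "1 \<le> d" unfolding d by (simp add: one_enat_def)
      moreover have "ks (Suc l) = ks l + d" using ks_Suc[of l] unfolding d by simp
      moreover have "enat d \<le> enat \<tau>max" "enat d \<le> trigger_time A B K N \<sigma> (q l) (E l)"
        unfolding d[symmetric] by simp_all
      ultimately show "ks l < ks (Suc l)" "ks (Suc l) - ks l \<le> \<tau>max"
        "enat (ks (Suc l) - ks l) \<le> trigger_time A B K N \<sigma> (q l) (E l)"
        by simp_all
    qed

    have E'_Suc: "E' (Suc l) = f (ks (Suc l) - ks l) * E' l" for l
      by (simp add: E'_def f_def)
    have E'pos: "E' l > 0" for l
    proof (induction l)
      case 0
      show ?case using \<open>E0 > 0\<close> assms by (simp add: E'_def)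
    next
      case (Suc l)
      then show ?case using fpos unfolding E'_Suc by simp
    qed
    have Epos: "E l > 0" for l
      using E'pos[of l] \<open>E0 > 0\<close> by (simp add: E_def E'_def state_bound_def)
    have E_le: "E l \<le> E' l" for l
      using \<open>E0 > 0\<close> assms by (simp add: E_def E'_def state_bound_def)

    have interval: "x (ks l + t) \<in> adapted_ball ?M \<gamma> (f t * E' l)"
      if ball: "x (ks l) \<in> adapted_ball ?M \<gamma> (E' l)" and bound: "infnorm (x (ks l)) \<le> E l"
        and t: "t \<le> ks (Suc l) - ks l" for l t
    proof -
      define T where "T = ks (Suc l) - ks l"
      define y where "y = (\<lambda>t. x (ks l + t))"
      define w where "w = (\<lambda>t. K *v q l - K *v y t)"
      have step: "y (Suc t) = A *v y t + B *v (K *v q l)" if "t < T" for t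
        using dyn[of "ks l + t"] hold[of l "ks l + t"] that
        unfolding y_def T_def by simp
      have err: "infnorm (y 0 - q l) \<le> E l / real N"
        using quantized_value_error[OF quant[OF Epos bound]] assms by (simp add: y_def)
      have small: "infnorm (w t) \<le> \<sigma> * E' l" if "t < T" for t
      proof -
        have "trigger_fun A B K N (q l) (E l) t \<le> \<sigma> * E l"
        proof (cases "t = 0")
          case True
          then show ?thesis
            using mult_right_mono[OF \<open>mat_infnorm K / real N \<le> \<sigma>\<close>, of "E l"] Epos[of l]
            by (simp add: trigger_fun_0)
        next
          case False
          have "enat t < enat T" using that by simp
          then have "enat t < trigger_time A B K N \<sigma> (q l) (E l)"
            using gap(3)[of l] unfolding T_def by (rule less_le_trans)
          then show ?thesis
            using False by (intro trigger_fun_le_before_trigger_time) auto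
        qed
        moreover have "infnorm (w t) \<le> trigger_fun A B K N (q l) (E l) t"
          unfolding w_def
          by (rule trigger_fun_bounds_input_error[of T]) (use step err that in auto)
        moreover have "\<sigma> * E l \<le> \<sigma> * E' l" using E_le assms by simp
        ultimately show ?thesis by linarith
      qed
      have "y t \<in> adapted_ball ?M \<gamma> (\<gamma> ^ t * E' l + (1 - \<gamma> ^ t) * (\<delta> * (\<sigma> * E' l)))"
      proof (rule perturbed_orbit_in_adapted_ball[of ?M \<Gamma> \<gamma> \<delta> B T y w])
        show "y (Suc t) = ?M *v y t + B *v w t" if "t < T" for t
          using step[OF that] by (simp add: w_def algebra_simps flip: matrix_vector_mul_assoc)
      qed (use growth small ball t assms in \<open>auto simp: y_def T_def\<close>)
      moreover have "\<gamma> ^ t * E' l + (1 - \<gamma> ^ t) * (\<delta> * (\<sigma> * E' l)) = f t * E' l"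
        by (simp add: f_def algebra_simps)
      ultimately show ?thesis by (simp add: y_def)
    qed

    \<comment> \<open>At time zero the bound is \<open>E0\<close> while the adapted norm is only bounded by \<open>\<Gamma> * E0\<close>,
        so the validity of \<open>E l\<close> is carried along as a separate invariant.\<close>
    have inv: "x (ks l) \<in> adapted_ball ?M \<gamma> (E' l) \<and> infnorm (x (ks l)) \<le> E l" for l
    proof (induction l)
      case 0
      show ?case
        using x0 mem_adapted_ball_of_infnorm_le[OF growth x0]
        by (simp add: ks0 E_def E'_def state_bound_def)
    next
      case (Suc l)
      have "x (ks (Suc l)) \<in> adapted_ball ?M \<gamma> (E' (Suc l))"
        using interval[of l "ks (Suc l) - ks l"] Suc gap(1)[of l] unfolding E'_Suc by simp
      moreover have "E (Suc l) = E' (Suc l)"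
        by (simp add: E_def E'_def state_bound_def)
      ultimately show ?case using adapted_ball_infnorm_le by metis
    qed

    have E'_le: "E' l \<le> \<Gamma> * E0 * \<omega> ^ ks l" for l
    proof (induction l)
      case 0
      show ?case by (simp add: E'_def ks0)
    next
      case (Suc l)
      have "E' (Suc l) \<le> \<omega> ^ (ks (Suc l) - ks l) * (\<Gamma> * E0 * \<omega> ^ ks l)"
        unfolding E'_Suc using Suc f_le[OF gap(2)] E'pos[of l] \<omega>0
        by (intro mult_mono) auto
      also have "\<dots> = \<Gamma> * E0 * \<omega> ^ (ks (Suc l) - ks l + ks l)"
        by (simp only: power_add mult_ac)
      also have "ks (Suc l) - ks l + ks l = ks (Suc l)"
        using gap(1)[of l] by simp
      finally show ?case .
    qed

    obtain l where l: "ks l \<le> k" "k < ks (Suc l)"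
      using interval_containing[OF ks0 gap(1)] by blast
    define t where "t = k - ks l"
    have t: "t \<le> ks (Suc l) - ks l" "k = t + ks l" using l by (auto simp: t_def)
    have "infnorm (x k) \<le> f t * E' l"
      using adapted_ball_infnorm_le[OF interval[of l t]] inv[of l] t by (simp add: add.commute)
    also have "\<dots> \<le> \<omega> ^ t * (\<Gamma> * E0 * \<omega> ^ ks l)"
    proof (rule mult_mono)
      show "f t \<le> \<omega> ^ t" using f_le t(1) gap(2)[of l] by simp
    qed (use E'_le E'pos[of l] \<omega>0 in auto)
    also have "\<dots> = \<Gamma> * E0 * \<omega> ^ k"
      unfolding t(2) by (simp only: power_add mult_ac)
    finally show ?thesis .
  qed
  then have "exponential_bound A B K sensor \<eta> N \<tau>max \<sigma> \<Gamma> \<gamma> \<delta> \<Gamma> \<omega>"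
    unfolding exponential_bound_def by blast
  moreover have "(\<gamma> ^ \<tau>max * (1 - \<delta> * \<sigma>) + \<delta> * \<sigma>) powr (1 / real \<tau>max) = \<omega>"
    by (simp add: \<omega>_def f_def)
  ultimately show ?thesis
    using \<omega>0 \<omega>1 \<open>\<Gamma> \<ge> 1\<close> unfolding Let_def by auto
qed

end
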